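(* There is an absolute constant $c>0$ such that every interval filament graph $G$ with $\alpha(G)\ge 2$ satisfies $$\beta(G)\le c\,\alpha(G)\log\alpha(G).$$
   Context: For a finite simple undirected graph $G$, $\alpha(G)$ is the size of a largest independent set and $\beta(G)$ is the clique cover number (the minimum number of cliques of $G$ whose union is $V(G)$). An interval filament graph is defined as follows: let $\mathcal I$ be a finite family of closed intervals on a line $L$ in the plane; for each interval $i\in\mathcal I$ choose a curve (filament) $f_i$ joining the two endpoints of $i$, lying in the closed half-plane above $L$ and within the vertical strip over $i$. A graph is an interval filament graph if it is isomorphic to the intersection graph of such a family of filaments. A known theorem of Gavril, used by the paper, states that every interval filament graph $G$ satisfies $E(G)=E(H_1)\cap E(H_2)$ for some graphs $H_1,H_2$ on the vertex set $V(G)$ with $E(G)\subseteq E(H_1)$, $E(G)\subseteq E(H_2)$, where $H_1$ is an interval graph and $H_2$ is an incomparability graph (a graph whose vertices are the elements of a finite partially ordered set, two being adjacent exactly when they are incomparable). *)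

theory Defs
  imports "HOL-Analysis.Analysis" "HOL-Library.Ramsey"
begin

definition simple_graph :: "'a set \<Rightarrow> 'a set set \<Rightarrow> bool" where
  "simple_graph V E \<longleftrightarrow> finite V \<and> E \<subseteq> [V]\<^bsup>2\<^esup>"

definition independence_number :: "'a set \<Rightarrow> 'a set set \<Rightarrow> nat" where
  "independence_number V E = Max (card ` {S. S \<subseteq> V \<and> indep S E})"

definition clique_cover_number :: "'a set \<Rightarrow> 'a set set \<Rightarrow> nat" where
  "clique_cover_number V E =
     Min (card ` {\<C>. (\<forall>K\<in>\<C>. K \<subseteq> V \<and> clique K E) \<and> \<Union>\<C> = V})"

definition intersection_graph_edges :: "'i set \<Rightarrow> ('i \<Rightarrow> 'p set) \<Rightarrow> 'i set set" where
  "intersection_graph_edges I S = {{i, j} | i j. i \<in> I \<and> j \<in> I \<and> i \<noteq> j \<and> S i \<inter> S j \<noteq> {}}"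

definition graph_isomorphic :: "'a set \<Rightarrow> 'a set set \<Rightarrow> 'b set \<Rightarrow> 'b set set \<Rightarrow> bool" where
  "graph_isomorphic V E V' E' \<longleftrightarrow>
     (\<exists>\<phi>. bij_betw \<phi> V V' \<and> (\<forall>u\<in>V. \<forall>v\<in>V. {u, v} \<in> E \<longleftrightarrow> {\<phi> u, \<phi> v} \<in> E'))"

text \<open>The line \<open>L\<close> is the horizontal coordinate axis of the plane \<open>real ^ 2\<close>.  Curves are
  continuous and need not be simple.\<close>

definition filament :: "real \<Rightarrow> real \<Rightarrow> (real \<Rightarrow> real ^ 2) \<Rightarrow> bool" where
  "filament a b f \<longleftrightarrow>
     path f \<and> pathstart f = vector [a, 0] \<and> pathfinish f = vector [b, 0] \<and>
     path_image f \<subseteq> {p. a \<le> p $ 1 \<and> p $ 1 \<le> b \<and> 0 \<le> p $ 2}"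

text \<open>Finite families are indexed by natural numbers, so repeated intervals are allowed; an interval
  may also be a single point.\<close>

definition interval_filament_graph :: "'a set \<Rightarrow> 'a set set \<Rightarrow> bool" where
  "interval_filament_graph V E \<longleftrightarrow>
     (\<exists>(I :: nat set) l r f.
        finite I \<and> (\<forall>i\<in>I. l i \<le> r i \<and> filament (l i) (r i) (f i)) \<and>
        graph_isomorphic V E I (intersection_graph_edges I (\<lambda>i. path_image (f i))))"

end

theory Submission
  imports Defs
begin

text \<open>
  Two filaments that do not meet lie over intervals that are either disjoint or strictly nested:
  if the endpoints interlaced, the curves would have to cross in the half-plane
  (\<open>disjoint_filaments_nested\<close>).  Moreover, "nested below without meeting" is a strict partial
  order.  Suppose \<open>f\<close> is below \<open>g\<close> and \<open>g\<close> is below \<open>h\<close>, but \<open>f\<close> met \<open>h\<close>; then following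
  \<open>h\<close> from its left end to a common point and \<open>f\<close> from there to its left end would give a curve
  whose endpoints interlace with those of \<open>g\<close>, so \<open>g\<close> would meet \<open>f\<close> or \<open>h\<close>
  (\<open>nested_disjoint_filaments_trans\<close>).  Hence among the intervals through a fixed point of the line,
  nonadjacency is comparability in a partial order.

  The rest is divide and conquer.  Let \<open>n\<close> be the independence number.  Filaments on different
  sides of a point never meet, so there is a point \<open>x\<close> of the line such that the filaments strictly
  to its left and those strictly to its right have independence numbers \<open>a\<close>, \<open>b\<close> that are both
  at most \<open>n / 2\<close> (\<open>balanced_point\<close>).  The filaments whose interval contains \<open>x\<close> need at
  most \<open>n\<close> cliques by Mirsky's theorem
  (\<open>clique_cover_number_le_if_nonadjacent_comparable\<close>).  So the clique cover number satisfies
  the recurrence \<open>T n \<le> n + T a + T b\<close> of merge sort, whose solution is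
  \<open>T n \<le> n * log 2 (2 * n)\<close>; this is at most \<open>2 * n * log 2 n\<close> for \<open>n \<ge> 2\<close>.
\<close>

section \<open>Independent sets and clique covers\<close>

lemma finite_clique_cover_cards:
  assumes "finite V"
  shows "finite (card ` {\<C>. (\<forall>K\<in>\<C>. K \<subseteq> V \<and> clique K E) \<and> \<Union>\<C> = V})"
proof (rule finite_imageI, rule finite_subset)
  show "{\<C>. (\<forall>K\<in>\<C>. K \<subseteq> V \<and> clique K E) \<and> \<Union>\<C> = V} \<subseteq> Pow (Pow V)" by auto
qed (use assms in simp)

lemma clique_cover_number_le:
  assumes "finite V" "\<And>K. K \<in> \<C> \<Longrightarrow> clique K E" "\<Union>\<C> = V"
  shows "clique_cover_number V E \<le> card \<C>"
  unfolding clique_cover_number_def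
  by (rule Min_le[OF finite_clique_cover_cards[OF assms(1)]]) (use assms in blast)

lemma clique_cover_exists:
  assumes "finite V"
  obtains \<C> where "\<And>K. K \<in> \<C> \<Longrightarrow> clique K E" "\<Union>\<C> = V" "card \<C> = clique_cover_number V E"
proof -
  have "(\<lambda>v. {v}) ` V \<in> {\<C>. (\<forall>K\<in>\<C>. K \<subseteq> V \<and> clique K E) \<and> \<Union>\<C> = V}"
    by (auto simp: clique_def)
  then have "card ` {\<C>. (\<forall>K\<in>\<C>. K \<subseteq> V \<and> clique K E) \<and> \<Union>\<C> = V} \<noteq> {}" by blast
  from Min_in[OF finite_clique_cover_cards[OF assms] this] show thesis
    unfolding clique_cover_number_def[symmetric] by (auto intro: that)
qed

lemma clique_cover_number_Un:
  assumes "finite A" "finite B"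
  shows "clique_cover_number (A \<union> B) E \<le> clique_cover_number A E + clique_cover_number B E"
proof -
  obtain \<A> where A: "\<And>K. K \<in> \<A> \<Longrightarrow> clique K E" "\<Union>\<A> = A" "card \<A> = clique_cover_number A E"
    by (rule clique_cover_exists[OF assms(1), of E]) blast
  obtain \<B> where B: "\<And>K. K \<in> \<B> \<Longrightarrow> clique K E" "\<Union>\<B> = B" "card \<B> = clique_cover_number B E"
    by (rule clique_cover_exists[OF assms(2), of E]) blast
  have "clique_cover_number (A \<union> B) E \<le> card (\<A> \<union> \<B>)"
    by (rule clique_cover_number_le) (use A B assms in auto)
  with card_Un_le[of \<A> \<B>] A B show ?thesis by simp
qed

lemma indep_le_independence_number:
  assumes "finite V" "S \<subseteq> V" "indep S E"
  shows "card S \<le> independence_number V E"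
  unfolding independence_number_def
  by (rule Max_ge) (use assms in auto)

lemma independence_number_attained:
  assumes "finite V"
  obtains S where "S \<subseteq> V" "indep S E" "card S = independence_number V E"
proof -
  have "{} \<in> {S. S \<subseteq> V \<and> indep S E}" by (simp add: indep_def)
  then have "card ` {S. S \<subseteq> V \<and> indep S E} \<noteq> {}" by blast
  moreover have "finite (card ` {S. S \<subseteq> V \<and> indep S E})" using assms by simp
  ultimately have "independence_number V E \<in> card ` {S. S \<subseteq> V \<and> indep S E}"
    unfolding independence_number_def by (intro Max_in)
  then show thesis by (metis (no_types, lifting) imageE mem_Collect_eq that)
qed

lemma independence_number_mono:
  assumes "finite V" "W \<subseteq> V"
  shows "independence_number W E \<le> independence_number V E"
proof -
  obtain S where "S \<subseteq> W" "indep S E" "card S = independence_number W E"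
    by (rule independence_number_attained[OF finite_subset[OF assms(2,1)], of E])
  with indep_le_independence_number[of V S E] assms show ?thesis by simp
qed

lemma independence_number_empty: "independence_number {} E = 0"
  using independence_number_attained[of "{}" E] by auto

lemma independence_number_pos:
  assumes "finite V" "V \<noteq> {}"
  shows "independence_number V E > 0"
proof -
  obtain v where "v \<in> V" using assms by blast
  with indep_le_independence_number[OF assms(1), of "{v}" E] show ?thesis
    by (simp add: indep_def)
qed

lemma independence_number_add:
  assumes "finite V" "A \<subseteq> V" "B \<subseteq> V" "A \<inter> B = {}"
    and nonadj: "\<And>u v. u \<in> A \<Longrightarrow> v \<in> B \<Longrightarrow> {u, v} \<notin> E"
  shows "independence_number A E + independence_number B E \<le> independence_number V E"
proof -
  have fin: "finite A" "finite B" using assms finite_subset by blast+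
  obtain S where S: "S \<subseteq> A" "indep S E" "card S = independence_number A E"
    using independence_number_attained[OF fin(1)] .
  obtain T where T: "T \<subseteq> B" "indep T E" "card T = independence_number B E"
    using independence_number_attained[OF fin(2)] .
  have "{u, v} \<notin> E" "{v, u} \<notin> E" if "u \<in> S" "v \<in> T" for u v
    using nonadj[of u v] that S T by (auto simp: insert_commute)
  then have "indep (S \<union> T) E"
    using S T by (auto simp: indep_def)
  then have "card (S \<union> T) \<le> independence_number V E"
    using S T assms by (intro indep_le_independence_number) auto
  moreover have "card (S \<union> T) = card S + card T"
    using S T assms fin by (intro card_Un_disjoint) (auto intro: finite_subset)
  ultimately show ?thesis using S T by simp
qed

section \<open>Incomparability graphs\<close>

text \<open>This is Mirsky's theorem: chains are the independent sets and antichains the cliques.  Vertices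
  of the same height, that is, with equally long longest chains strictly below them, are
  pairwise incomparable, and the height is smaller than the length of a longest chain.\<close>

lemma clique_cover_number_le_if_nonadjacent_comparable:
  fixes less :: "'a \<Rightarrow> 'a \<Rightarrow> bool"  (infix "\<sqsubset>" 50)
  assumes fin: "finite W"
    and compar: "\<And>u v. u \<in> W \<Longrightarrow> v \<in> W \<Longrightarrow> u \<noteq> v \<Longrightarrow> {u, v} \<notin> E \<Longrightarrow> u \<sqsubset> v \<or> v \<sqsubset> u"
    and nonadj: "\<And>u v. u \<in> W \<Longrightarrow> v \<in> W \<Longrightarrow> u \<sqsubset> v \<Longrightarrow> u \<noteq> v \<and> {u, v} \<notin> E"
    and trans: "\<And>u v w. u \<in> W \<Longrightarrow> v \<in> W \<Longrightarrow> w \<in> W \<Longrightarrow> u \<sqsubset> v \<Longrightarrow> v \<sqsubset> w \<Longrightarrow> u \<sqsubset> w"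
  shows "clique_cover_number W E \<le> independence_number W E"
proof -
  define D where "D v = {u \<in> W. u \<sqsubset> v}" for v
  define h where "h v = independence_number (D v) E" for v
  have finD: "finite (D v)" for v using fin by (simp add: D_def)
  have h_less: "h u < h v" if "u \<in> W" "v \<in> W" "u \<sqsubset> v" for u v
  proof -
    obtain S where S: "S \<subseteq> D u" "indep S E" "card S = h u"
      unfolding h_def using independence_number_attained[OF finD] .
    have "u \<notin> S" using S nonadj that unfolding D_def by blast
    have "{x, u} \<notin> E" "{u, x} \<notin> E" if "x \<in> S" for x
      using nonadj[of x u] S that \<open>u \<in> W\<close> by (auto simp: D_def insert_commute)
    then have "indep (insert u S) E" using S by (auto simp: indep_def)
    moreover have "insert u S \<subseteq> D v"
    proof
      fix x assume "x \<in> insert u S"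
      then show "x \<in> D v" using S that trans[of x u v] by (auto simp: D_def)
    qed
    ultimately have "card (insert u S) \<le> h v"
      unfolding h_def by (intro indep_le_independence_number finD)
    with \<open>u \<notin> S\<close> S finD show ?thesis by (simp add: finite_subset card_insert_disjoint)
  qed
  have h_bound: "h v < independence_number W E" if "v \<in> W" for v
  proof -
    have "independence_number (D v) E + independence_number {v} E \<le> independence_number W E"
      by (rule independence_number_add) (use fin that nonadj in \<open>auto simp: D_def\<close>)
    with independence_number_pos[of "{v}" E] show ?thesis by (simp add: h_def)
  qed
  define \<C> where "\<C> = (\<lambda>k. {v \<in> W. h v = k}) ` {..<independence_number W E}"
  have "clique_cover_number W E \<le> card \<C>"
  proof (rule clique_cover_number_le[OF fin])
    have "{u, v} \<in> E" if "u \<in> W" "v \<in> W" "u \<noteq> v" "h u = h v" for u v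
      using compar[OF that(1-3)] h_less[of u v] h_less[of v u] that by auto
    then show "clique K E" if "K \<in> \<C>" for K
      using that unfolding \<C>_def clique_def by auto
    show "\<Union>\<C> = W" using h_bound by (auto simp: \<C>_def)
  qed
  also have "\<dots> \<le> independence_number W E"
    unfolding \<C>_def using card_image_le[of "{..<independence_number W E}"] by fastforce
  finally show ?thesis .
qed

section \<open>Divide and conquer along the line\<close>

text \<open>Sweep \<open>x\<close> over the right ends and stop as soon as the intervals ending by \<open>x\<close> contain
  more than half of the independence number.  Before \<open>x\<close> at most half was reached, and since the
  intervals beginning after \<open>x\<close> can be combined with those ending by \<open>x\<close>, less than half
  remains for them.\<close>

lemma balanced_point:
  fixes l r :: "'a \<Rightarrow> real"
  assumes fin: "finite W" and ne: "W \<noteq> {}"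
    and lr: "\<And>v. v \<in> W \<Longrightarrow> l v \<le> r v"
    and disjoint: "\<And>u v. u \<in> W \<Longrightarrow> v \<in> W \<Longrightarrow> r u < l v \<Longrightarrow> {u, v} \<notin> E"
  obtains x where
    "2 * independence_number {v \<in> W. r v < x} E \<le> independence_number W E"
    "2 * independence_number {v \<in> W. x < l v} E \<le> independence_number W E"
proof -
  define n where "n = independence_number W E"
  define A where "A x = independence_number {v \<in> W. r v \<le> x} E" for x
  define X where "X = {x \<in> r ` W. n < 2 * A x}"
  have "n > 0" unfolding n_def using fin ne by (rule independence_number_pos)
  have "{v \<in> W. r v \<le> Max (r ` W)} = W" using fin by auto
  then have "Max (r ` W) \<in> X"
    using \<open>n > 0\<close> Max_in[of "r ` W"] fin ne by (simp add: X_def A_def n_def)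
  moreover have finX: "finite X" using fin by (simp add: X_def)
  ultimately have xX: "Min X \<in> X" by (intro Min_in) auto
  define x where "x = Min X"
  have sum: "A x + independence_number {v \<in> W. x < l v} E \<le> n"
    unfolding A_def n_def
  proof (rule independence_number_add[OF fin])
    show "{v \<in> W. r v \<le> x} \<inter> {v \<in> W. x < l v} = {}" using lr by fastforce
  qed (use disjoint in auto)
  have "2 * independence_number {v \<in> W. r v < x} E \<le> n"
  proof (rule ccontr)
    assume *: "\<not> ?thesis"
    \<comment> \<open>The last right end before \<open>x\<close> would already have stopped the sweep.\<close>
    define L where "L = {v \<in> W. r v < x}"
    have "L \<noteq> {}"
      using * independence_number_empty[of E] unfolding L_def by force
    moreover have "finite L" using fin by (simp add: L_def)
    ultimately have y: "Max (r ` L) \<in> r ` L" by (intro Max_in) auto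
    have "r v \<le> Max (r ` L)" if "v \<in> L" for v using that \<open>finite L\<close> by simp
    moreover have "Max (r ` L) < x" using y by (auto simp: L_def)
    ultimately have "{v \<in> W. r v \<le> Max (r ` L)} = L" by (force simp: L_def)
    then have "Max (r ` L) \<in> X"
      using * y by (auto simp: X_def A_def L_def)
    then have "x \<le> Max (r ` L)" unfolding x_def using finX by simp
    with y show False by (auto simp: L_def)
  qed
  moreover have "n < 2 * A x" using xX by (simp add: X_def x_def)
  ultimately show thesis using sum by (intro that[of x]) (simp_all add: n_def)
qed

text \<open>Halving the argument turns \<open>log 2 (2 * a)\<close> into at most \<open>log 2 n\<close>, which is one less than
  \<open>log 2 (2 * n)\<close>; summed up, the saving pays for the extra \<open>n\<close>.\<close>

lemma log_recurrence:
  fixes a b n :: nat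
  assumes "n > 0" "2 * a \<le> n" "2 * b \<le> n"
  shows "n + (a * log 2 (2 * a) + b * log 2 (2 * b)) \<le> n * log 2 (2 * n)"
proof -
  have *: "k * log 2 (2 * k) \<le> k * log 2 n" if "2 * k \<le> n" for k :: nat
  proof (cases "k = 0")
    case False
    then have "log 2 (2 * k) \<le> log 2 n" using that by (simp flip: of_nat_mult)
    then show ?thesis by (rule mult_left_mono) simp
  qed simp
  have "real n + (a * log 2 (2 * a) + b * log 2 (2 * b)) \<le> n + (a + b) * log 2 n"
    using *[OF assms(2)] *[OF assms(3)] by (simp add: distrib_right)
  also have "\<dots> \<le> n + n * log 2 n"
    using assms by (intro add_left_mono mult_right_mono) auto
  also have "\<dots> = n * log 2 (2 * n)"
    using assms by (simp add: log_mult distrib_left)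
  finally show ?thesis .
qed

text \<open>The intervals through a balanced point overlap pairwise, so nonadjacency of their vertices is
  comparability and Mirsky's theorem applies to them; the two remaining sides have at most half
  the independence number and are covered recursively.\<close>

lemma clique_cover_number_le_log:
  fixes l r :: "'a \<Rightarrow> real" and less :: "'a \<Rightarrow> 'a \<Rightarrow> bool"  (infix "\<sqsubset>" 50)
  assumes fin: "finite V"
    and lr: "\<And>v. v \<in> V \<Longrightarrow> l v \<le> r v"
    and disjoint: "\<And>u v. u \<in> V \<Longrightarrow> v \<in> V \<Longrightarrow> r u < l v \<Longrightarrow> {u, v} \<notin> E"
    and compar: "\<And>u v. u \<in> V \<Longrightarrow> v \<in> V \<Longrightarrow> u \<noteq> v \<Longrightarrow> {u, v} \<notin> E \<Longrightarrow>
                   l u \<le> r v \<Longrightarrow> l v \<le> r u \<Longrightarrow> u \<sqsubset> v \<or> v \<sqsubset> u"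
    and nonadj: "\<And>u v. u \<in> V \<Longrightarrow> v \<in> V \<Longrightarrow> u \<sqsubset> v \<Longrightarrow> u \<noteq> v \<and> {u, v} \<notin> E"
    and trans: "\<And>u v w. u \<in> V \<Longrightarrow> v \<in> V \<Longrightarrow> w \<in> V \<Longrightarrow> u \<sqsubset> v \<Longrightarrow> v \<sqsubset> w \<Longrightarrow> u \<sqsubset> w"
    and W: "W \<subseteq> V"
  shows "clique_cover_number W E
           \<le> independence_number W E * log 2 (2 * independence_number W E)"
  using W
proof (induction "independence_number W E" arbitrary: W rule: less_induct)
  case less
  define n where "n = independence_number W E"
  have finW: "finite W" using less.prems fin finite_subset by blast
  show ?case
  proof (cases "W = {}")
    case True
    have "clique_cover_number {} E \<le> card ({} :: 'a set set)"
      by (rule clique_cover_number_le) auto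
    then show ?thesis using True by (simp add: independence_number_empty)
  next
    case False
    have "n > 0" unfolding n_def using finW False by (rule independence_number_pos)
    obtain x where x:
      "2 * independence_number {v \<in> W. r v < x} E \<le> independence_number W E"
      "2 * independence_number {v \<in> W. x < l v} E \<le> independence_number W E"
    proof (rule balanced_point[of W l r E])
      show "l v \<le> r v" if "v \<in> W" for v using that lr less.prems by blast
      show "{u, v} \<notin> E" if "u \<in> W" "v \<in> W" "r u < l v" for u v
        using that disjoint less.prems by blast
    qed (use finW False in auto)
    define L where "L = {v \<in> W. r v < x}"
    define R where "R = {v \<in> W. x < l v}"
    define M where "M = {v \<in> W. l v \<le> x \<and> x \<le> r v}"
    note x = x[folded L_def R_def n_def]
    have fins: "finite L" "finite R" "finite M" using finW by (auto simp: L_def R_def M_def)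
    have sub: "L \<subseteq> V" "R \<subseteq> V" using less.prems by (auto simp: L_def R_def)
    have "independence_number L E < independence_number W E"
      "independence_number R E < independence_number W E"
      using x \<open>n > 0\<close> unfolding n_def by linarith+
    note IH = less.hyps[OF this(1) sub(1)] less.hyps[OF this(2) sub(2)]
    have "clique_cover_number M E \<le> independence_number M E"
    proof (rule clique_cover_number_le_if_nonadjacent_comparable[OF fins(3), of E less])
      show "u \<sqsubset> v \<or> v \<sqsubset> u" if "u \<in> M" "v \<in> M" "u \<noteq> v" "{u, v} \<notin> E" for u v
        using that less.prems by (intro compar) (auto simp: M_def)
      show "u \<noteq> v \<and> {u, v} \<notin> E" if "u \<in> M" "v \<in> M" "u \<sqsubset> v" for u v
        using that less.prems by (intro nonadj) (auto simp: M_def)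
      show "u \<sqsubset> w" if "u \<in> M" "v \<in> M" "w \<in> M" "u \<sqsubset> v" "v \<sqsubset> w" for u v w
        by (rule trans[of u v w]) (use that less.prems in \<open>auto simp: M_def\<close>)
    qed
    also have "\<dots> \<le> n" unfolding n_def using finW by (intro independence_number_mono) (auto simp: M_def)
    finally have M: "clique_cover_number M E \<le> n" .
    have "W = M \<union> (L \<union> R)" by (auto simp: L_def R_def M_def)
    then have "clique_cover_number W E
        \<le> clique_cover_number M E + (clique_cover_number L E + clique_cover_number R E)"
      using clique_cover_number_Un[of M "L \<union> R" E] clique_cover_number_Un[of L R E] fins by simp
    then have "real (clique_cover_number W E)
        \<le> n + (independence_number L E * log 2 (2 * independence_number L E)
              + independence_number R E * log 2 (2 * independence_number R E))"
      using M IH by linarith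
    also have "\<dots> \<le> n * log 2 (2 * n)"
      using log_recurrence[OF \<open>n > 0\<close> x] by simp
    finally show ?thesis by (simp add: n_def)
  qed
qed

section \<open>Filaments\<close>

text \<open>In the upper half-plane, a curve separates the points of the line between its ends from
  those outside;
  placing both curves in a box that stands on the line reduces this to Fashoda's theorem.\<close>

lemma interlaced_paths_meet:
  fixes f g :: "real \<Rightarrow> real ^ 2"
  assumes "path f" "path g"
    and upper: "path_image f \<subseteq> {p. 0 \<le> p $ 2}" "path_image g \<subseteq> {p. 0 \<le> p $ 2}"
    and ends: "pathstart f = vector [a, 0]" "pathfinish f = vector [c, 0]"
              "pathstart g = vector [b, 0]" "pathfinish g = vector [d, 0]"
    and less: "a < b" "b < c" "c < d"
  shows "path_image f \<inter> path_image g \<noteq> {}"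
proof -
  have "bounded (path_image f \<union> path_image g)"
    using assms(1,2) by (simp add: bounded_path_image)
  then obtain B where B: "\<And>p. p \<in> path_image f \<union> path_image g \<Longrightarrow> norm p \<le> B"
    by (auto simp: bounded_iff)
  define lo hi :: "real ^ 2" where "lo = vector [- B, 0]" and "hi = vector [B, B]"
  have in_box: "p \<in> cbox lo hi" if "p \<in> path_image f \<union> path_image g" for p
  proof -
    have "\<bar>p $ 1\<bar> \<le> B" "\<bar>p $ 2\<bar> \<le> B"
      using B[OF that] component_le_norm_cart order_trans by blast+
    moreover have "0 \<le> p $ 2" using that upper by blast
    ultimately show ?thesis by (simp add: mem_box_cart forall_2 lo_def hi_def abs_le_iff)
  qed
  obtain z where "z \<in> path_image f" "z \<in> path_image g"
    by (rule fashoda_interlace[of f g lo hi])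
      (use assms(1,2) in_box ends less in \<open>auto simp: lo_def\<close>)
  then show ?thesis by blast
qed

lemma filament_ends:
  assumes "filament a b f"
  shows "vector [a, 0] \<in> path_image f" "vector [b, 0] \<in> path_image f"
  using assms pathstart_in_path_image[of f] pathfinish_in_path_image[of f]
  by (auto simp: filament_def)

text \<open>Filaments that share an endpoint meet there, so all endpoint inequalities are strict, and
  interlacing is the only remaining alternative to nesting.\<close>

lemma disjoint_filaments_nested:
  assumes f: "filament a b f" and g: "filament c d g"
    and disj: "path_image f \<inter> path_image g = {}"
    and meet: "a \<le> d" "c \<le> b"
  shows "(a < c \<and> d < b) \<or> (c < a \<and> b < d)"
proof -
  have "a \<noteq> c" "b \<noteq> d" "a \<noteq> d" "b \<noteq> c"
    using filament_ends[OF f] filament_ends[OF g] disj by auto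
  moreover have "\<not> (a < c \<and> c < b \<and> b < d)"
    using interlaced_paths_meet[of f g a b c d] f g disj unfolding filament_def by blast
  moreover have "\<not> (c < a \<and> a < d \<and> d < b)"
    using interlaced_paths_meet[of g f c d a b] f g disj unfolding filament_def by blast
  ultimately show ?thesis using meet by linarith
qed

text \<open>If the inner filament \<open>f\<close> met the outer filament \<open>h\<close>, their union would contain a curve from
  the left end of \<open>h\<close> to that of \<open>f\<close>.  The left end of \<open>g\<close> lies between these two and its right end
  lies outside, so \<open>g\<close> would meet this curve.\<close>

lemma nested_disjoint_filaments_trans:
  assumes f: "filament a b f" and g: "filament c d g" and h: "filament p q h"
    and fg: "path_image f \<inter> path_image g = {}" and gh: "path_image g \<inter> path_image h = {}"
    and nested: "c < a" "a < d" "p < c"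
  shows "path_image f \<inter> path_image h = {}"
proof (rule ccontr)
  assume "path_image f \<inter> path_image h \<noteq> {}"
  then have "path_connected (path_image h \<union> path_image f)"
    using f h by (intro path_connected_Un) (auto simp: filament_def path_connected_path_image)
  then obtain k where k: "path k" "path_image k \<subseteq> path_image h \<union> path_image f"
      "pathstart k = vector [p, 0]" "pathfinish k = vector [a, 0]"
    unfolding path_connected_def using filament_ends[OF f] filament_ends[OF h] by blast
  have "path_image k \<inter> path_image g \<noteq> {}"
    by (rule interlaced_paths_meet[of k g p a c d])
      (use f g h k nested in \<open>auto simp: filament_def\<close>)
  with k fg gh show False by blast
qed

theorem mainTheorem3:
  shows "\<exists>c::real. c > 0 \<and>
    (\<forall>(V :: 'a set) (E :: 'a set set).
       simple_graph V E \<and> interval_filament_graph V E \<and> independence_number V E \<ge> 2 \<longrightarrow>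
       real (clique_cover_number V E)
         \<le> c * real (independence_number V E) * ln (real (independence_number V E)))"
proof (intro exI[of _ "2 / ln 2"] conjI allI impI)
  fix V :: "'a set" and E :: "'a set set"
  assume "simple_graph V E \<and> interval_filament_graph V E \<and> independence_number V E \<ge> 2"
  then have fin: "finite V" and filam: "interval_filament_graph V E"
    and ge2: "independence_number V E \<ge> 2"
    by (auto simp: simple_graph_def)
  define n where "n = independence_number V E"
  obtain I :: "nat set" and l r f \<phi> where
    fil: "\<And>i. i \<in> I \<Longrightarrow> l i \<le> r i \<and> filament (l i) (r i) (f i)"
    and bij: "bij_betw \<phi> V I"
    and iso: "\<And>u v. u \<in> V \<Longrightarrow> v \<in> V \<Longrightarrow>
      {u, v} \<in> E \<longleftrightarrow> {\<phi> u, \<phi> v} \<in> intersection_graph_edges I (\<lambda>i. path_image (f i))"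
    using filam unfolding interval_filament_graph_def graph_isomorphic_def by blast
  define a where "a v = l (\<phi> v)" for v
  define b where "b v = r (\<phi> v)" for v
  define F where "F v = f (\<phi> v)" for v
  have in_I: "\<phi> v \<in> I" if "v \<in> V" for v using bij that by (auto simp: bij_betw_def)
  have ab: "a v \<le> b v" and F: "filament (a v) (b v) (F v)" if "v \<in> V" for v
    using fil in_I[OF that] by (auto simp: a_def b_def F_def)
  have adj: "{u, v} \<in> E \<longleftrightarrow> u \<noteq> v \<and> path_image (F u) \<inter> path_image (F v) \<noteq> {}"
    if "u \<in> V" "v \<in> V" for u v
  proof -
    have "\<phi> u = \<phi> v \<longleftrightarrow> u = v" using bij that by (auto simp: bij_betw_def inj_on_def)
    moreover have "{\<phi> u, \<phi> v} \<in> intersection_graph_edges I (\<lambda>i. path_image (f i)) \<longleftrightarrow>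
        \<phi> u \<noteq> \<phi> v \<and> path_image (F u) \<inter> path_image (F v) \<noteq> {}"
      using in_I[OF that(1)] in_I[OF that(2)]
      unfolding intersection_graph_edges_def F_def mem_Collect_eq doubleton_eq_iff
      by (metis inf_commute)
    ultimately show ?thesis using iso[OF that] by simp
  qed
  define less where
    "less u v \<longleftrightarrow> a v < a u \<and> b u < b v \<and> path_image (F u) \<inter> path_image (F v) = {}" for u v
  have "real (clique_cover_number V E) \<le> n * log 2 (2 * n)"
    unfolding n_def
  proof (rule clique_cover_number_le_log[of V a b E less])
    fix u v assume uv: "u \<in> V" "v \<in> V"
    show "{u, v} \<notin> E" if "b u < a v"
      using F[OF uv(1)] F[OF uv(2)] that adj[OF uv] unfolding filament_def by fastforce
    show "less u v \<or> less v u" if "u \<noteq> v" "{u, v} \<notin> E" "a u \<le> b v" "a v \<le> b u"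
      using disjoint_filaments_nested[OF F[OF uv(1)] F[OF uv(2)]] adj[OF uv] that
      by (auto simp: less_def)
    show "u \<noteq> v \<and> {u, v} \<notin> E" if "less u v"
      using that adj[OF uv] by (auto simp: less_def)
    fix w assume w: "w \<in> V" and uvw: "less u v" "less v w"
    have "path_image (F u) \<inter> path_image (F w) = {}"
      by (rule nested_disjoint_filaments_trans[OF F[OF uv(1)] F[OF uv(2)] F[OF w]])
        (use uvw ab[OF uv(1)] in \<open>auto simp: less_def\<close>)
    then show "less u w" using uvw by (auto simp: less_def)
  qed (use fin ab in auto)
  also have "\<dots> \<le> n * (2 * log 2 n)"
  proof (rule mult_left_mono)
    have "log 2 (2 * n) \<le> log 2 (n * n)"
      using ge2 by (subst log_le_cancel_iff) (auto simp: n_def)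
    also have "\<dots> = 2 * log 2 n" using ge2 by (simp add: log_mult n_def)
    finally show "log 2 (2 * n) \<le> 2 * log 2 n" by simp
  qed simp
  also have "\<dots> = 2 / ln 2 * n * ln n" by (simp add: log_def)
  finally show "real (clique_cover_number V E)
      \<le> 2 / ln 2 * real (independence_number V E) * ln (real (independence_number V E))"
    by (simp add: n_def)
qed simp

end
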